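(* The set of rational values $\rho\in(-1,1)$ admitting a genuine apex pair is dense in $(-1,1)$.
   Context: A rational triangle is a triangle with rational side lengths (its area need not be rational). For $\rho\in\mathbb{Q}\cap(-1,1)$ let $\theta\in(0,\pi)$ be the angle with $\cos\theta=\rho$. A genuine pair for $\rho$ is a pair $(T,I)$ of non-degenerate rational triangles such that $T$ has an angle equal to $\theta$, $I$ is isosceles, $T$ and $I$ have the same perimeter and the same area, and $T$ and $I$ are not congruent. A genuine apex pair for $\rho$ is a genuine pair $(T,I)$ for $\rho$ in which $T$ is itself isosceles with $\theta$ as its apex angle, i.e. $\theta$ is the angle between two equal sides of $T$. *)

theory Defs
  imports "HOL-Analysis.Analysis"
begin

text \<open>A triangle is given by its three vertices in the Euclidean plane; degenerate
  (collinear) triples are excluded separately, by \<open>nondegenerate\<close>.\<close>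

type_synonym triangle = "(real ^ 2) \<times> (real ^ 2) \<times> (real ^ 2)"

fun nondegenerate :: "triangle \<Rightarrow> bool" where
  "nondegenerate (A, B, C) \<longleftrightarrow> \<not> collinear {A, B, C}"

fun rational_triangle :: "triangle \<Rightarrow> bool" where
  "rational_triangle (A, B, C) \<longleftrightarrow> dist A B \<in> \<rat> \<and> dist B C \<in> \<rat> \<and> dist C A \<in> \<rat>"

fun perimeter :: "triangle \<Rightarrow> real" where
  "perimeter (A, B, C) = dist A B + dist B C + dist C A"

fun area :: "triangle \<Rightarrow> real" where
  "area (A, B, C) = measure lborel (convex hull {A, B, C})"

fun isosceles :: "triangle \<Rightarrow> bool" where
  "isosceles (A, B, C) \<longleftrightarrow> dist A B = dist C A \<or> dist A B = dist B C \<or> dist B C = dist C A"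

text \<open>Triangles are unlabelled for the purpose of congruence: the isometry of the plane may match
  the vertices in any order and may reverse orientation.\<close>

fun congruent_triangles :: "triangle \<Rightarrow> triangle \<Rightarrow> bool" where
  "congruent_triangles (A, B, C) (A', B', C') \<longleftrightarrow>
     (\<exists>f :: real ^ 2 \<Rightarrow> real ^ 2. (\<forall>x y. dist (f x) (f y) = dist x y) \<and>
        f ` {A, B, C} = {A', B', C'})"

text \<open>The unoriented angle at the vertex \<open>V\<close> between the rays towards \<open>P\<close> and \<open>Q\<close>, in \<open>[0, \<pi>]\<close>;
  only meaningful for \<open>P \<noteq> V\<close> and \<open>Q \<noteq> V\<close>.\<close>

definition angle_at :: "real ^ 2 \<Rightarrow> real ^ 2 \<Rightarrow> real ^ 2 \<Rightarrow> real" where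
  "angle_at V P Q = arccos (((P - V) \<bullet> (Q - V)) / (norm (P - V) * norm (Q - V)))"

fun has_angle :: "triangle \<Rightarrow> real \<Rightarrow> bool" where
  "has_angle (A, B, C) \<theta> \<longleftrightarrow>
     angle_at A B C = \<theta> \<or> angle_at B C A = \<theta> \<or> angle_at C A B = \<theta>"

fun isosceles_with_apex_angle :: "triangle \<Rightarrow> real \<Rightarrow> bool" where
  "isosceles_with_apex_angle (A, B, C) \<theta> \<longleftrightarrow>
     (dist A B = dist C A \<and> angle_at A B C = \<theta>) \<or>
     (dist A B = dist B C \<and> angle_at B C A = \<theta>) \<or>
     (dist B C = dist C A \<and> angle_at C A B = \<theta>)"

text \<open>In the next two definitions \<open>\<rho>\<close> is meant to be a rational number in \<open>(-1, 1)\<close>, so that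
  \<open>arccos \<rho>\<close> is the angle in \<open>(0, \<pi>)\<close> with cosine \<open>\<rho>\<close>.\<close>

definition genuine_pair :: "real \<Rightarrow> triangle \<Rightarrow> triangle \<Rightarrow> bool" where
  "genuine_pair \<rho> T I \<longleftrightarrow>
     nondegenerate T \<and> rational_triangle T \<and>
     nondegenerate I \<and> rational_triangle I \<and>
     has_angle T (arccos \<rho>) \<and> isosceles I \<and>
     perimeter T = perimeter I \<and> area T = area I \<and>
     \<not> congruent_triangles T I"

definition genuine_apex_pair :: "real \<Rightarrow> triangle \<Rightarrow> triangle \<Rightarrow> bool" where
  "genuine_apex_pair \<rho> T I \<longleftrightarrow>
     genuine_pair \<rho> T I \<and> isosceles_with_apex_angle T (arccos \<rho>)"

end

theory Submission
  imports Defs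
begin

text \<open>An isosceles triangle with legs \<open>a\<close> and base \<open>b\<close> has perimeter \<open>2 * a + b\<close> and satisfies
  \<open>16 * area\<^sup>2 = b\<^sup>2 * (2 * a + b) * (2 * a - b)\<close>. Two such triangles, with legs and bases \<open>a, b\<close>
  and \<open>c, d\<close>, therefore share perimeter and area as soon as \<open>2 * a + b = 2 * c + d\<close> and
  \<open>b\<^sup>2 * (2 * a - b) = d\<^sup>2 * (2 * c - d)\<close>. If the perimeter is \<open>p\<close>, then \<open>2 * a - b = p - 2 * b\<close>, and
  for \<open>b \<noteq> d\<close> the second equation can be divided by \<open>b - d\<close>, which leaves an equation linear in \<open>p\<close>:
  \<open>p * (b + d) = 2 * (b\<^sup>2 + b * d + d\<^sup>2)\<close>. So the bases may be any two distinct positive rational numbers,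
  and the rational legs are then determined (\<open>leg\<close> below); the triangle inequality holds
  automatically, because \<open>2 * a - b = 2 * d\<^sup>2 / (b + d)\<close> is positive.

  Scaling to \<open>d = 1\<close> and writing \<open>t\<close> for \<open>b\<close>, the apex angle of the first triangle has cosine
  \<open>1 - 2 * x\<^sup>2\<close> with \<open>x = (t\<^sup>2 + t) / (t\<^sup>2 + t + 2)\<close>. As \<open>t\<close> runs through the positive reals, \<open>x\<close> takes
  every value in \<open>(0, 1)\<close>, so the cosine takes every value in \<open>(-1, 1)\<close>. The positive rationals
  other than \<open>1\<close> are dense among the positive reals, and by continuity so are their cosines
  in \<open>(-1, 1)\<close>.\<close>

section \<open>Isosceles triangles with given legs and base\<close>

definition apex :: "real \<Rightarrow> real \<Rightarrow> real ^ 2" where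
  "apex a b = vector [0, sqrt (4 * a\<^sup>2 - b\<^sup>2) / 2]"

definition base_left :: "real \<Rightarrow> real ^ 2" where
  "base_left b = vector [- b / 2, 0]"

definition base_right :: "real \<Rightarrow> real ^ 2" where
  "base_right b = vector [b / 2, 0]"

definition isosceles_triangle :: "real \<Rightarrow> real \<Rightarrow> triangle" where
  "isosceles_triangle a b = (apex a b, base_left b, base_right b)"

lemmas vertex_defs = apex_def base_left_def base_right_def

lemma isosceles_radicand_pos:
  fixes a b :: real
  assumes "0 < b" "b < 2 * a"
  shows "0 < 4 * a\<^sup>2 - b\<^sup>2"
proof -
  have "b\<^sup>2 < (2 * a)\<^sup>2"
    using assms by (intro power_strict_mono) auto
  then show ?thesis by (simp add: power_mult_distrib)
qed

lemma dist_vertices: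
  assumes "0 < b" "b < 2 * a"
  shows "dist (apex a b) (base_left b) = a"
    and "dist (base_left b) (base_right b) = b"
    and "dist (base_right b) (apex a b) = a"
proof -
  have "b\<^sup>2 / 4 + (4 * a\<^sup>2 - b\<^sup>2) / 4 = a\<^sup>2"
    by (simp add: field_simps)
  then show "dist (apex a b) (base_left b) = a"
    and "dist (base_left b) (base_right b) = b"
    and "dist (base_right b) (apex a b) = a"
    using assms isosceles_radicand_pos[OF assms]
    by (simp_all add: vertex_defs dist_vec_def L2_set_def sum_2 dist_real_def power_divide)
qed

lemma angle_at_apex:
  assumes "0 < b" "b < 2 * a"
  shows "angle_at (apex a b) (base_left b) (base_right b) = arccos (1 - b\<^sup>2 / (2 * a\<^sup>2))"
proof -
  let ?P = "base_left b - apex a b" and ?Q = "base_right b - apex a b"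
  have "norm ?P = a" "norm ?Q = a"
    using dist_vertices(1,3)[OF assms] by (simp_all add: dist_norm norm_minus_commute)
  moreover have "?P \<bullet> ?Q = a\<^sup>2 - b\<^sup>2 / 2"
    using isosceles_radicand_pos[OF assms]
    by (simp add: vertex_defs inner_vec_def sum_2 field_simps power2_eq_square[symmetric])
  moreover have "(a\<^sup>2 - b\<^sup>2 / 2) / (a * a) = 1 - b\<^sup>2 / (2 * a\<^sup>2)"
    using assms by (simp add: field_simps power2_eq_square)
  ultimately show ?thesis
    unfolding angle_at_def by simp
qed

lemma nondegenerate_isosceles_triangle:
  assumes "0 < b" "b < 2 * a"
  shows "nondegenerate (isosceles_triangle a b)"
proof -
  have False if "collinear {apex a b, base_left b, base_right b}"
  proof -
    from that obtain u where
      u: "\<forall>x \<in> {apex a b, base_left b, base_right b}.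
            \<forall>y \<in> {apex a b, base_left b, base_right b}. \<exists>c. x - y = c *\<^sub>R u"
      unfolding collinear_def by blast
    then obtain k l where k: "base_right b - base_left b = k *\<^sub>R u"
      and l: "apex a b - base_left b = l *\<^sub>R u"
      by blast
    have "b = k * u $ 1" "0 = k * u $ 2"
      using arg_cong[OF k, of "\<lambda>v. v $ 1"] arg_cong[OF k, of "\<lambda>v. v $ 2"]
      by (simp_all add: vertex_defs)
    then have "u $ 2 = 0"
      using assms by auto
    then show False
      using arg_cong[OF l, of "\<lambda>v. v $ 2"] isosceles_radicand_pos[OF assms]
      by (simp add: vertex_defs)
  qed
  then show ?thesis
    by (auto simp: isosceles_triangle_def)
qed

lemma area_isosceles_triangle:
  assumes "0 < b" "b < 2 * a"
  shows "area (isosceles_triangle a b) = b * sqrt (4 * a\<^sup>2 - b\<^sup>2) / 4"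
  using assms isosceles_radicand_pos[OF assms]
  by (simp add: isosceles_triangle_def content_triangle vertex_defs abs_mult)

lemma area_isosceles_triangle_eqI:
  assumes ab: "0 < b" "b < 2 * a" and cd: "0 < d" "d < 2 * c"
    and perim: "2 * a + b = 2 * c + d"
    and "b\<^sup>2 * (2 * a - b) = d\<^sup>2 * (2 * c - d)"
  shows "area (isosceles_triangle a b) = area (isosceles_triangle c d)"
proof -
  have factor: "z * sqrt (4 * x\<^sup>2 - z\<^sup>2) = sqrt ((2 * x + z) * (z\<^sup>2 * (2 * x - z)))"
    if "0 < z" for x z :: real
  proof -
    have "(2 * x + z) * (z\<^sup>2 * (2 * x - z)) = z\<^sup>2 * (4 * x\<^sup>2 - z\<^sup>2)"
      by (simp add: algebra_simps power2_eq_square)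
    then show ?thesis
      using that by (simp only: real_sqrt_mult real_sqrt_abs abs_of_pos)
  qed
  show ?thesis
    using assms by (simp add: area_isosceles_triangle factor)
qed

text \<open>A congruence preserves the set of distances between vertices, so \<open>{a, b} = {c, d}\<close>. With equal
  perimeters this forces \<open>b = d\<close>: in the crossed case \<open>a = d\<close>, \<open>b = c\<close> the perimeter equation
  gives \<open>a = b\<close>.\<close>

lemma not_congruent_isosceles_triangles:
  assumes ab: "0 < b" "b < 2 * a" and cd: "0 < d" "d < 2 * c"
    and perim: "2 * a + b = 2 * c + d" and "b \<noteq> d"
  shows "\<not> congruent_triangles (isosceles_triangle a b) (isosceles_triangle c d)"
proof
  define distances :: "(real ^ 2) set \<Rightarrow> real set"
    where "distances S = (\<Union>x\<in>S. (\<lambda>y. dist x y) ` S)" for S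
  have distances_image: "distances (f ` S) = distances S"
    if "\<forall>x y. dist (f x) (f y) = dist x y" for f S
    using that by (simp add: distances_def image_image)
  have distances_vertices: "distances {apex x z, base_left z, base_right z} = {0, x, z}"
    if "0 < z" "z < 2 * x" for x z
    using dist_vertices[OF that] by (auto simp: distances_def dist_commute)
  assume "congruent_triangles (isosceles_triangle a b) (isosceles_triangle c d)"
  then obtain f where f: "\<forall>x y. dist (f x) (f y) = dist x y"
    and image: "f ` {apex a b, base_left b, base_right b} = {apex c d, base_left d, base_right d}"
    unfolding isosceles_triangle_def congruent_triangles.simps by blast
  have "{0, a, b} = {0, c, d}"
    using distances_image[OF f, of "{apex a b, base_left b, base_right b}"]
    unfolding image distances_vertices[OF ab] distances_vertices[OF cd] by simp
  then have "a \<in> {0, c, d}" "b \<in> {0, c, d}" "c \<in> {0, a, b}" "d \<in> {0, a, b}"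
    by blast+
  then show False
    using assms by auto
qed

section \<open>Two isosceles triangles with equal perimeter and area\<close>

text \<open>The leg on base \<open>b\<close>, when \<open>d\<close> is the base of the partner triangle: it is \<open>(p - b) / 2\<close> for the
  common perimeter \<open>p = 2 * (b\<^sup>2 + b * d + d\<^sup>2) / (b + d)\<close>.\<close>

definition leg :: "real \<Rightarrow> real \<Rightarrow> real" where
  "leg b d = (b\<^sup>2 + b * d + 2 * d\<^sup>2) / (2 * (b + d))"

lemma leg_perimeter:
  assumes "0 < b" "0 < d"
  shows "2 * leg b d + b = 2 * (b\<^sup>2 + b * d + d\<^sup>2) / (b + d)"
  using assms by (simp add: leg_def field_simps power2_eq_square)

lemma leg_excess:
  assumes "0 < b" "0 < d"
  shows "2 * leg b d - b = 2 * d\<^sup>2 / (b + d)"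
  using assms by (simp add: leg_def field_simps power2_eq_square)

lemma base_less_twice_leg:
  assumes "0 < b" "0 < d"
  shows "b < 2 * leg b d"
proof -
  have "0 < 2 * d\<^sup>2 / (b + d)"
    using assms by simp
  then show ?thesis
    using leg_excess[OF assms] by linarith
qed

lemma leg_rational:
  assumes "b \<in> \<rat>" "d \<in> \<rat>"
  shows "leg b d \<in> \<rat>"
  unfolding leg_def using assms by (intro Rats_divide Rats_add Rats_mult Rats_power) auto

text \<open>Both perimeter and \<open>b\<^sup>2 * (2 * a - b) = 2 * b\<^sup>2 * d\<^sup>2 / (b + d)\<close> are symmetric in \<open>b\<close> and \<open>d\<close>, which is
  why exchanging the bases changes neither perimeter nor area.\<close>

lemma genuine_apex_pair_of_bases:
  assumes b: "b \<in> \<rat>" "0 < b" and d: "d \<in> \<rat>" "0 < d" and "b \<noteq> d"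
  shows "genuine_apex_pair (1 - b\<^sup>2 / (2 * (leg b d)\<^sup>2))
           (isosceles_triangle (leg b d) b) (isosceles_triangle (leg d b) d)"
proof -
  note ab = \<open>0 < b\<close> base_less_twice_leg[OF \<open>0 < b\<close> \<open>0 < d\<close>]
  note cd = \<open>0 < d\<close> base_less_twice_leg[OF \<open>0 < d\<close> \<open>0 < b\<close>]
  have perim: "2 * leg b d + b = 2 * leg d b + d"
    unfolding leg_perimeter[OF b(2) d(2)] leg_perimeter[OF d(2) b(2)]
    by (simp add: algebra_simps)
  have "b\<^sup>2 * (2 * leg b d - b) = d\<^sup>2 * (2 * leg d b - d)"
    unfolding leg_excess[OF b(2) d(2)] leg_excess[OF d(2) b(2)]
    by (simp add: algebra_simps)
  with perim have "area (isosceles_triangle (leg b d) b) = area (isosceles_triangle (leg d b) d)"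
    by (rule area_isosceles_triangle_eqI[OF ab cd])
  moreover have "\<not> congruent_triangles (isosceles_triangle (leg b d) b)
                    (isosceles_triangle (leg d b) d)"
    using perim \<open>b \<noteq> d\<close> by (rule not_congruent_isosceles_triangles[OF ab cd])
  moreover have "nondegenerate (isosceles_triangle (leg b d) b)"
    "nondegenerate (isosceles_triangle (leg d b) d)"
    using nondegenerate_isosceles_triangle[OF ab] nondegenerate_isosceles_triangle[OF cd] .
  ultimately show ?thesis
    using perim b d leg_rational[of b d] leg_rational[of d b]
    unfolding genuine_apex_pair_def genuine_pair_def
    by (simp add: isosceles_triangle_def dist_vertices[OF ab] dist_vertices[OF cd]
        angle_at_apex[OF ab])
qed

section \<open>Density of the apex cosines\<close>

text \<open>The cosine \<open>1 - b\<^sup>2 / (2 * a\<^sup>2)\<close> for the bases \<open>b = t\<close> and \<open>d = 1\<close>.\<close>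

definition apex_cosine :: "real \<Rightarrow> real" where
  "apex_cosine t = 1 - 2 * ((t\<^sup>2 + t) / (t\<^sup>2 + t + 2))\<^sup>2"

lemma apex_cosine_eq:
  assumes "0 < t"
  shows "1 - t\<^sup>2 / (2 * (leg t 1)\<^sup>2) = apex_cosine t"
proof -
  have "t / leg t 1 = 2 * ((t\<^sup>2 + t) / (t\<^sup>2 + t + 2))"
    using assms by (simp add: leg_def field_simps power2_eq_square)
  then have "t\<^sup>2 / (leg t 1)\<^sup>2 = (2 * ((t\<^sup>2 + t) / (t\<^sup>2 + t + 2)))\<^sup>2"
    by (metis power_divide)
  then have "t\<^sup>2 / (leg t 1)\<^sup>2 / 2 = 2 * ((t\<^sup>2 + t) / (t\<^sup>2 + t + 2))\<^sup>2"
    by (simp only: power_mult_distrib) simp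
  then show ?thesis
    by (simp add: apex_cosine_def mult.commute)
qed

lemma apex_cosine_bounds:
  assumes "0 < t"
  shows "-1 < apex_cosine t" "apex_cosine t < 1"
proof -
  let ?x = "(t\<^sup>2 + t) / (t\<^sup>2 + t + 2)"
  have "0 < t\<^sup>2 + t"
    using assms by (simp add: add_pos_pos)
  then have "0 < ?x" "?x < 1"
    by simp_all
  then have "0 < ?x\<^sup>2" "?x\<^sup>2 < 1"
    by (auto intro: power_less_one_iff[THEN iffD2] simp del: power_divide)
  then show "-1 < apex_cosine t" "apex_cosine t < 1"
    unfolding apex_cosine_def by linarith+
qed

lemma apex_cosine_rational: "t \<in> \<rat> \<Longrightarrow> apex_cosine t \<in> \<rat>"
  unfolding apex_cosine_def by (intro Rats_diff Rats_divide Rats_add Rats_mult Rats_power) auto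

lemma isCont_apex_cosine:
  assumes "0 < t"
  shows "isCont apex_cosine t"
proof -
  have "t\<^sup>2 + t + 2 \<noteq> 0"
    using assms by (smt (verit) zero_le_power2)
  then show ?thesis
    unfolding apex_cosine_def by (intro continuous_intros) auto
qed

lemma apex_cosine_surj:
  assumes "-1 < y" "y < 1"
  obtains t where "0 < t" "apex_cosine t = y"
proof -
  \<comment> \<open>Solve in turn \<open>y = 1 - 2 * x\<^sup>2\<close>, \<open>x = u / (u + 2)\<close> and \<open>u = t\<^sup>2 + t\<close>.\<close>
  define x where "x = sqrt ((1 - y) / 2)"
  have x: "0 < x" "x < 1" "x\<^sup>2 = (1 - y) / 2"
    using assms by (auto simp: x_def)
  define u where "u = 2 * x / (1 - x)"
  have "0 < u" "u / (u + 2) = x"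
    using x by (auto simp: u_def field_simps)
  define t where "t = (sqrt (1 + 4 * u) - 1) / 2"
  have "0 < t"
    using \<open>0 < u\<close> by (simp add: t_def)
  have "2 * t + 1 = sqrt (1 + 4 * u)"
    by (simp add: t_def field_simps)
  then have "(2 * t + 1)\<^sup>2 = 1 + 4 * u"
    using \<open>0 < u\<close> by simp
  then have "t\<^sup>2 + t = u"
    by (simp add: power2_eq_square algebra_simps)
  then have "apex_cosine t = y"
    using \<open>u / (u + 2) = x\<close> x(3) by (simp add: apex_cosine_def)
  with \<open>0 < t\<close> show thesis
    by (rule that)
qed

theorem corollary5p3:
  shows "{-1<..<1} \<subseteq> closure {\<rho> :: real. \<rho> \<in> \<rat> \<and> -1 < \<rho> \<and> \<rho> < 1 \<and>
           (\<exists>T I. genuine_apex_pair \<rho> T I)}"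
    (is "_ \<subseteq> closure ?S")
proof
  fix y :: real
  assume "y \<in> {-1<..<1}"
  then obtain t where t: "0 < t" "apex_cosine t = y"
    by (auto elim: apex_cosine_surj)
  have mem: "apex_cosine q \<in> ?S" if "q \<in> \<rat>" "0 < q" "q \<noteq> 1" for q
  proof -
    have "genuine_apex_pair (apex_cosine q)
            (isosceles_triangle (leg q 1) q) (isosceles_triangle (leg 1 q) 1)"
      using genuine_apex_pair_of_bases[of q 1] that by (simp add: apex_cosine_eq)
    then show ?thesis
      using apex_cosine_rational[OF that(1)] apex_cosine_bounds[OF that(2)]
      by (intro CollectI conjI exI)
  qed
  show "y \<in> closure ?S"
    unfolding closure_approachable
  proof (intro allI impI)
    fix e :: real
    assume "0 < e"
    with isCont_apex_cosine[OF t(1)] obtain \<delta> where "0 < \<delta>"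
      and \<delta>: "\<And>q. dist q t < \<delta> \<Longrightarrow> dist (apex_cosine q) (apex_cosine t) < e"
      unfolding continuous_at_eps_delta by (metis dist_commute)
    \<comment> \<open>Stopping at \<open>1\<close> if \<open>t < 1\<close> keeps \<open>q\<close> away from \<open>1\<close>, where the two triangles coincide.\<close>
    define s where "s = (if t < 1 then min (t + \<delta>) 1 else t + \<delta>)"
    have "t < s"
      using \<open>0 < \<delta>\<close> by (simp add: s_def)
    then obtain q where "q \<in> \<rat>" "t < q" "q < s"
      using Rats_dense_in_real by blast
    then have q: "dist q t < \<delta>" "0 < q" "q \<noteq> 1"
      using t(1) by (auto simp: s_def dist_real_def split: if_splits)
    have "dist (apex_cosine q) y < e"
      using \<delta>[OF q(1)] t(2) by simp
    then show "\<exists>z\<in>?S. dist z y < e"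
      using mem[OF \<open>q \<in> \<rat>\<close> q(2,3)] by (rule bexI)
  qed
qed

end
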